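(* For every integer $n\ge0$, the polynomials $P_{010}(n)$, $P_{000}(n)$ and $P_{001}(n)$ in $q$ are palindromic. That is, writing $P_c(n)=P_c(n;q)$, $$P_c(n;q)=q^{\deg(P_c(n;q))}\,P_c(n;q^{-1})$$ for $c=010$, $000$ and $001$, where $\deg$ denotes the degree in $q$.
   Context: For partitions $\lambda=(\lambda_1,\lambda_2,\dots)$, $\mu=(\mu_1,\mu_2,\dots)$ (weakly decreasing, padded by zeros) write $\lambda\succeq\mu$ if $\lambda_1\ge\mu_1\ge\lambda_2\ge\mu_2\ge\cdots$ and $\lambda\preceq\mu$ if $\mu_1\ge\lambda_1\ge\mu_2\ge\lambda_2\ge\cdots$. A skew double shifted plane partition (DSPP) with profile $\delta=\delta_1\delta_2\delta_3\in\{0,1\}^3$ is a 4-tuple of integer partitions $(\lambda^0,\lambda^1,\lambda^2,\lambda^3)$ with $\lambda^{j-1}\succeq\lambda^j$ if $\delta_j=0$ and $\lambda^{j-1}\preceq\lambda^j$ if $\delta_j=1$ ($j=1,2,3$). Its size $|\Lambda|$ is the sum of all parts of the four partitions; its diagonal length is the maximum of the numbers of (positive) parts of the four partitions. For a profile $c$ let $\mathrm{DSPP}_{c}(n)$ be the set of DSPPs with profile $c$ and diagonal length at most $n$, $F_{c}(n)=\sum_{\Lambda\in\mathrm{DSPP}_{c}(n)}q^{|\Lambda|}$, and $P_{c}(n)=(q;q)_{4n}F_{c}(n)$, where $(q;q)_{m}=\prod_{i=1}^{m}(1-q^i)$; each of these $P_c(n)$ is a polynomial in $q$. *)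

theory Defs
  imports
    "HOL-Computational_Algebra.Formal_Laurent_Series"
    "HOL-Computational_Algebra.Polynomial_FPS"
begin

text \<open>
  Integer partitions are encoded as weakly decreasing sequences of natural numbers, padded by
  zeros. Indexing starts at 0, so \<open>\<nu> i\<close> is the part usually written \<open>\<nu>\<^sub>i\<^sub>+\<^sub>1\<close>.
\<close>

definition is_partition :: "(nat \<Rightarrow> nat) \<Rightarrow> bool" where
  "is_partition \<nu> \<longleftrightarrow> antimono \<nu> \<and> finite {i. \<nu> i > 0}"

definition psize :: "(nat \<Rightarrow> nat) \<Rightarrow> nat" where
  "psize \<nu> = (\<Sum>i | \<nu> i > 0. \<nu> i)"

definition plength :: "(nat \<Rightarrow> nat) \<Rightarrow> nat" where
  "plength \<nu> = card {i. \<nu> i > 0}"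

definition interlaces :: "(nat \<Rightarrow> nat) \<Rightarrow> (nat \<Rightarrow> nat) \<Rightarrow> bool" where
  "interlaces \<nu> \<mu> \<longleftrightarrow> (\<forall>i. \<nu> i \<ge> \<mu> i \<and> \<mu> i \<ge> \<nu> (Suc i))"

text \<open>
  One step of a profile: the entry 0 stands for \<open>\<nu> \<succeq> \<mu>\<close> and the entry 1 for \<open>\<nu> \<preceq> \<mu>\<close>, which is
  \<open>\<mu> \<succeq> \<nu>\<close>. Any other entry admits no pair.
\<close>

definition profile_step :: "nat \<Rightarrow> (nat \<Rightarrow> nat) \<Rightarrow> (nat \<Rightarrow> nat) \<Rightarrow> bool" where
  "profile_step d \<nu> \<mu> \<longleftrightarrow> (d = 0 \<and> interlaces \<nu> \<mu>) \<or> (d = 1 \<and> interlaces \<mu> \<nu>)"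

type_synonym profile = "nat \<times> nat \<times> nat"

type_synonym quad = "(nat \<Rightarrow> nat) \<times> (nat \<Rightarrow> nat) \<times> (nat \<Rightarrow> nat) \<times> (nat \<Rightarrow> nat)"

fun is_dspp :: "profile \<Rightarrow> quad \<Rightarrow> bool" where
  "is_dspp (d1, d2, d3) (l0, l1, l2, l3) \<longleftrightarrow>
     is_partition l0 \<and> is_partition l1 \<and> is_partition l2 \<and> is_partition l3 \<and>
     profile_step d1 l0 l1 \<and> profile_step d2 l1 l2 \<and> profile_step d3 l2 l3"

fun dspp_size :: "quad \<Rightarrow> nat" where
  "dspp_size (l0, l1, l2, l3) = psize l0 + psize l1 + psize l2 + psize l3"

fun diag_length :: "quad \<Rightarrow> nat" where
  "diag_length (l0, l1, l2, l3) = Max {plength l0, plength l1, plength l2, plength l3}"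

definition DSPP :: "profile \<Rightarrow> nat \<Rightarrow> quad set" where
  "DSPP c n = {\<Lambda>. is_dspp c \<Lambda> \<and> diag_length \<Lambda> \<le> n}"

text \<open>
  The generating function \<open>\<Sum>\<Lambda>\<in>DSPP c n. q ^ |\<Lambda>|\<close> as a formal power series, given by its
  coefficients; the cardinalities are those of finite sets by \<open>finite_DSPP_size\<close> below.
\<close>

definition F_dspp :: "profile \<Rightarrow> nat \<Rightarrow> int fps" where
  "F_dspp c n = Abs_fps (\<lambda>m. int (card {\<Lambda> \<in> DSPP c n. dspp_size \<Lambda> = m}))"

definition qpoch :: "nat \<Rightarrow> int fps" where
  "qpoch m = (\<Prod>i = 1..m. 1 - fps_X ^ i)"

definition P_dspp :: "profile \<Rightarrow> nat \<Rightarrow> int fps" where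
  "P_dspp c n = qpoch (4 * n) * F_dspp c n"

text \<open>
  The identity \<open>p(q) = q ^ deg p * p(q\<^sup>-\<^sup>1)\<close>, read in the ring of Laurent series in
  \<open>q = fls_X\<close>.
\<close>

definition palindromic :: "int poly \<Rightarrow> bool" where
  "palindromic p \<longleftrightarrow>
     poly (map_poly fls_const p) fls_X =
       fls_X ^ degree p * poly (map_poly fls_const p) fls_X_inv"

lemma finite_partitions_of_size: "finite {\<nu>. is_partition \<nu> \<and> psize \<nu> \<le> m}"
proof (rule finite_subset)
  let ?B = "{\<nu>. \<forall>i. (i \<in> {..<m} \<longrightarrow> \<nu> i \<in> {..m}) \<and> (i \<notin> {..<m} \<longrightarrow> \<nu> i = (0::nat))}"
  show "finite ?B"
    by (rule finite_set_of_finite_funs) auto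
  show "{\<nu>. is_partition \<nu> \<and> psize \<nu> \<le> m} \<subseteq> ?B"
  proof (clarify, intro conjI impI)
    fix \<nu> :: "nat \<Rightarrow> nat" and i
    assume p: "is_partition \<nu>" and s: "psize \<nu> \<le> m"
    from p have fin: "finite {i. \<nu> i > 0}" and anti: "antimono \<nu>"
      by (auto simp: is_partition_def)
    have "\<nu> i \<le> psize \<nu>"
    proof (cases "\<nu> i > 0")
      case True
      then show ?thesis
        unfolding psize_def using fin by (intro member_le_sum) auto
    qed simp
    with s show "\<nu> i \<in> {..m}" by simp
    assume i: "i \<notin> {..<m}"
    show "\<nu> i = 0"
    proof (rule ccontr)
      assume "\<nu> i \<noteq> 0"
      then have "{..i} \<subseteq> {i. \<nu> i > 0}"
        using antimonoD[OF anti] by (auto simp: Suc_le_eq[symmetric] intro: order_trans)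
      then have "Suc i \<le> card {i. \<nu> i > 0}"
        using card_mono[OF fin, of "{..i}"] by simp
      also have "\<dots> = (\<Sum>i | \<nu> i > 0. 1)" by simp
      also have "\<dots> \<le> psize \<nu>"
        unfolding psize_def by (rule sum_mono) auto
      finally show False using s i by simp
    qed
  qed
qed

lemma finite_DSPP_size: "finite {\<Lambda> \<in> DSPP c n. dspp_size \<Lambda> = m}"
proof -
  let ?A = "{\<nu>. is_partition \<nu> \<and> psize \<nu> \<le> m}"
  have "{\<Lambda> \<in> DSPP c n. dspp_size \<Lambda> = m} \<subseteq> ?A \<times> ?A \<times> ?A \<times> ?A"
    by (cases c) (auto simp: DSPP_def)
  then show ?thesis
    using finite_partitions_of_size[of m] by (meson finite_SigmaI finite_subset)
qed

end

theory Submission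
  imports Defs "HOL-Library.Product_Lexorder"
begin

text \<open>
  The entries of a DSPP of diagonal length at most \<open>n\<close> are the values of a map \<open>\<sigma>\<close> from the
  \<open>4n\<close> positions \<open>(j, i)\<close> (row \<open>j < 4\<close>, part \<open>i < n\<close>) to the naturals, and the interlacing
  conditions say that \<open>\<sigma>\<close> is weakly increasing along a relation \<open>R\<close> on the positions. So
  \<open>F\<close> counts the \<open>P\<close>-partitions of a poset, and palindromicity is an instance of Stanley's
  reciprocity argument for graded posets.

  Number the \<open>p\<close> positions injectively by \<open>\<omega>\<close>, compatibly with \<open>R\<close>. Sorting the positions by
  the lexicographic key \<open>(\<sigma> x, \<omega> x)\<close> yields a linear extension \<open>w\<close> of \<open>R\<close>, and the \<open>\<sigma>\<close> with
  a given \<open>w\<close> have generating function \<open>q ^ maj \<omega> w / (q;q)\<^sub>p\<close> (\<open>gf_sorted_along\<close>). Hence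
  \<open>(q;q)\<^sub>p\<close> times the generating function of the weakly increasing maps is
  \<open>W(q) = (\<Sum>w. q ^ maj \<omega> w)\<close>, summed over the linear extensions (\<open>gf_ppartitions\<close>). With
  \<open>-\<omega>\<close> in place of \<open>\<omega>\<close>, ties are broken against \<open>R\<close>: the same linear extensions now sort the
  strictly increasing maps, and ascents and descents of \<open>\<omega>\<close> along \<open>w\<close> change roles. As
  \<open>maj \<omega> w + maj (-\<omega>) w = p(p-1)/2\<close> (\<open>maj_add_maj_uminus\<close>), the strict count is
  \<open>q ^ (p(p-1)/2) * W(1/q)\<close>.

  On the other hand, if \<open>R\<close> has a height function \<open>h\<close> that rises by exactly 1 along every pair in
  \<open>R\<close> and vanishes at every position with nothing below it, then \<open>\<sigma> \<mapsto> \<sigma> + h\<close> is a bijection from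
  weakly to strictly increasing maps, so the strict count is also \<open>q ^ (sum of h) * W(q)\<close>.
  Comparing the two expressions gives the symmetry of \<open>W\<close> (\<open>palindromic_gf_graded\<close>). For the
  profiles 010, 000 and 001 such an \<open>h\<close> exists: it falls by 2 from each part to the next in its
  row, and at the last part it is \<open>1, 0, 1, 0\<close>, respectively \<open>3, 2, 1, 0\<close> and \<open>2, 1, 0, 1\<close>, in
  the four rows.
\<close>

section \<open>Counting generating functions\<close>

definition gf :: "'a set \<Rightarrow> ('a \<Rightarrow> nat) \<Rightarrow> int fps" where
  "gf A s = Abs_fps (\<lambda>m. int (card {a \<in> A. s a = m}))"

lemma gf_shift_bij:
  assumes f: "bij_betw f A B" and st: "\<And>a. a \<in> A \<Longrightarrow> t (f a) = s a + k"
  shows "gf B t = fps_X ^ k * gf A s"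
proof (rule fps_ext)
  fix m
  have "bij_betw f {a \<in> A. s a + k = m} {b \<in> B. t b = m}"
    using f st by (auto simp: bij_betw_def inj_on_def)
  then have *: "card {b \<in> B. t b = m} = card {a \<in> A. s a + k = m}"
    by (simp add: bij_betw_same_card)
  show "gf B t $ m = (fps_X ^ k * gf A s) $ m"
  proof (cases "m < k")
    case True
    then have "{a \<in> A. s a + k = m} = {}" by auto
    with * True show ?thesis by (simp add: gf_def fps_X_power_mult_nth)
  next
    case False
    then have "{a \<in> A. s a + k = m} = {a \<in> A. s a = m - k}" by auto
    with * False show ?thesis by (simp add: gf_def fps_X_power_mult_nth)
  qed
qed

lemma gf_UN_disjoint:
  assumes "finite I" and fin: "\<And>i m. i \<in> I \<Longrightarrow> finite {a \<in> B i. s a = m}"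
    and disj: "\<And>i j. i \<in> I \<Longrightarrow> j \<in> I \<Longrightarrow> i \<noteq> j \<Longrightarrow> B i \<inter> B j = {}"
  shows "gf (\<Union>i\<in>I. B i) s = (\<Sum>i\<in>I. gf (B i) s)"
proof (rule fps_ext)
  fix m
  have "{a \<in> (\<Union>i\<in>I. B i). s a = m} = (\<Union>i\<in>I. {a \<in> B i. s a = m})"
    by auto
  moreover have "card (\<Union>i\<in>I. {a \<in> B i. s a = m}) = (\<Sum>i\<in>I. card {a \<in> B i. s a = m})"
    using assms by (intro card_UN_disjoint) blast+
  ultimately show "gf (\<Union>i\<in>I. B i) s $ m = (\<Sum>i\<in>I. gf (B i) s) $ m"
    by (simp add: gf_def fps_sum_nth)
qed

lemma finite_supported_funs_of_sum:
  fixes S :: "'a set"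
  assumes "finite S"
  shows "finite {\<sigma> :: 'a \<Rightarrow> nat. (\<forall>x. x \<notin> S \<longrightarrow> \<sigma> x = 0) \<and> sum \<sigma> S = m}"
proof (rule finite_subset)
  show "finite {\<sigma>. \<forall>x. (x \<in> S \<longrightarrow> \<sigma> x \<in> {..m}) \<and> (x \<notin> S \<longrightarrow> \<sigma> x = (0::nat))}"
    using assms by (intro finite_set_of_finite_funs) auto
  show "{\<sigma> :: 'a \<Rightarrow> nat. (\<forall>x. x \<notin> S \<longrightarrow> \<sigma> x = 0) \<and> sum \<sigma> S = m} \<subseteq>
      {\<sigma>. \<forall>x. (x \<in> S \<longrightarrow> \<sigma> x \<in> {..m}) \<and> (x \<notin> S \<longrightarrow> \<sigma> x = (0::nat))}"
    using assms by (auto intro: member_le_sum)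
qed

section \<open>Maps sorted along a list\<close>

text \<open>Pairs are ordered lexicographically, so \<open>\<omega>\<close> only breaks ties between equal values of \<open>\<sigma>\<close>.\<close>

abbreviation key :: "('a \<Rightarrow> int) \<Rightarrow> ('a \<Rightarrow> nat) \<Rightarrow> 'a \<Rightarrow> nat \<times> int" where
  "key \<omega> \<sigma> x \<equiv> (\<sigma> x, \<omega> x)"

definition sorted_along :: "('a \<Rightarrow> int) \<Rightarrow> 'a list \<Rightarrow> ('a \<Rightarrow> nat) set" where
  "sorted_along \<omega> w = {\<sigma>. (\<forall>x. x \<notin> set w \<longrightarrow> \<sigma> x = 0) \<and>
     sorted_wrt (\<lambda>y x. key \<omega> \<sigma> y < key \<omega> \<sigma> x) w}"

text \<open>
  The major index of \<open>w\<close>, with positions counted from the right: the maps in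
  \<open>sorted_along \<omega> w\<close> rise from left to right, and a strict rise required between two neighbours
  raises every later entry by 1, so a descent of \<open>\<omega>\<close> contributes the number of later entries.
\<close>
fun maj :: "('a \<Rightarrow> int) \<Rightarrow> 'a list \<Rightarrow> nat" where
  "maj \<omega> [] = 0"
| "maj \<omega> [y] = 0"
| "maj \<omega> (y # x # w) = (if \<omega> y < \<omega> x then 0 else length (x # w)) + maj \<omega> (x # w)"

text \<open>
  Each gap between neighbours is a descent for exactly one of \<open>\<omega>\<close> and \<open>-\<omega>\<close>, so together the two
  indices collect the contribution of every gap.
\<close>
lemma maj_add_maj_uminus:
  assumes "distinct w" "inj_on \<omega> (set w)"
  shows "maj \<omega> w + maj (\<lambda>x. - \<omega> x) w = \<Sum>{..<length w}"
  using assms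
proof (induction \<omega> w rule: maj.induct)
  case (3 \<omega> y x w)
  then have "\<omega> y \<noteq> \<omega> x" by (auto simp: inj_on_def)
  moreover have "maj \<omega> (x # w) + maj (\<lambda>x. - \<omega> x) (x # w) = \<Sum>{..<length (x # w)}"
    using 3 by simp
  ultimately show ?case by (auto simp: algebra_simps)
qed auto

text \<open>
  The first entry is the smallest, so if it is positive then 1 can be subtracted from all entries
  without disturbing their order.
\<close>
lemma gf_sorted_along_positive:
  assumes S: "finite S" "set (y # w) \<subseteq> S" and d: "distinct (y # w)"
  shows "gf {\<sigma> \<in> sorted_along \<omega> (y # w). \<sigma> y > 0} (\<lambda>\<sigma>. sum \<sigma> S) =
    fps_X ^ length (y # w) * gf (sorted_along \<omega> (y # w)) (\<lambda>\<sigma>. sum \<sigma> S)"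
proof (rule gf_shift_bij)
  let ?up = "\<lambda>(\<sigma>::'a \<Rightarrow> nat) x. if x \<in> set (y # w) then Suc (\<sigma> x) else 0"
  let ?dn = "\<lambda>(\<sigma>::'a \<Rightarrow> nat) x. \<sigma> x - 1"
  have up: "?up \<sigma> \<in> sorted_along \<omega> (y # w)" if "\<sigma> \<in> sorted_along \<omega> (y # w)" for \<sigma>
  proof -
    have "sorted_wrt (\<lambda>a b. key \<omega> (?up \<sigma>) a < key \<omega> (?up \<sigma>) b) (y # w)"
      by (rule sorted_wrt_mono_rel[of _ "\<lambda>a b. key \<omega> \<sigma> a < key \<omega> \<sigma> b"])
        (use that in \<open>auto simp: sorted_along_def\<close>)
    then show ?thesis unfolding sorted_along_def by simp
  qed
  have pos: "\<sigma> x > 0" if "\<sigma> \<in> sorted_along \<omega> (y # w)" "\<sigma> y > 0" "x \<in> set (y # w)" for \<sigma> x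
    using that by (auto simp: sorted_along_def)
  have dn: "?dn \<sigma> \<in> sorted_along \<omega> (y # w)" if "\<sigma> \<in> sorted_along \<omega> (y # w)" "\<sigma> y > 0" for \<sigma>
  proof -
    have "sorted_wrt (\<lambda>a b. key \<omega> (?dn \<sigma>) a < key \<omega> (?dn \<sigma>) b) (y # w)"
    proof (rule sorted_wrt_mono_rel[of _ "\<lambda>a b. key \<omega> \<sigma> a < key \<omega> \<sigma> b"])
      fix a b
      assume "a \<in> set (y # w)" "b \<in> set (y # w)" "key \<omega> \<sigma> a < key \<omega> \<sigma> b"
      then show "key \<omega> (?dn \<sigma>) a < key \<omega> (?dn \<sigma>) b"
        using pos[OF that, of a] pos[OF that, of b] by auto
    qed (use that in \<open>auto simp: sorted_along_def\<close>)
    then show ?thesis using that unfolding sorted_along_def by simp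
  qed
  show "bij_betw ?up (sorted_along \<omega> (y # w)) {\<sigma> \<in> sorted_along \<omega> (y # w). \<sigma> y > 0}"
  proof (rule bij_betw_byWitness[where f' = ?dn])
    show "\<forall>\<sigma>\<in>sorted_along \<omega> (y # w). ?dn (?up \<sigma>) = \<sigma>"
      by (auto simp: sorted_along_def fun_eq_iff)
    show "\<forall>\<sigma>\<in>{\<sigma> \<in> sorted_along \<omega> (y # w). \<sigma> y > 0}. ?up (?dn \<sigma>) = \<sigma>"
    proof (intro ballI ext)
      fix \<sigma> x
      assume "\<sigma> \<in> {\<sigma> \<in> sorted_along \<omega> (y # w). \<sigma> y > 0}"
      then show "?up (?dn \<sigma>) x = \<sigma> x"
        using pos[of \<sigma> x] by (cases "x \<in> set (y # w)") (auto simp: sorted_along_def)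
    qed
    show "?up ` sorted_along \<omega> (y # w) \<subseteq> {\<sigma> \<in> sorted_along \<omega> (y # w). \<sigma> y > 0}"
      using up by auto
    show "?dn ` {\<sigma> \<in> sorted_along \<omega> (y # w). \<sigma> y > 0} \<subseteq> sorted_along \<omega> (y # w)"
      using dn by auto
  qed
  fix \<sigma> assume \<sigma>: "\<sigma> \<in> sorted_along \<omega> (y # w)"
  have "sum (?up \<sigma>) S = (\<Sum>x\<in>S. \<sigma> x + (if x \<in> set (y # w) then 1 else 0))"
    using \<sigma> by (intro sum.cong) (auto simp: sorted_along_def)
  also have "\<dots> = sum \<sigma> S + card (S \<inter> set (y # w))"
    using S by (simp add: sum.distrib sum.If_cases Int_def)
  also have "S \<inter> set (y # w) = set (y # w)"
    using S by blast
  also have "card (set (y # w)) = length (y # w)"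
    using d by (rule distinct_card)
  finally show "sum (?up \<sigma>) S = sum \<sigma> S + length (y # w)" .
qed

lemma finite_sorted_along_of_sum:
  assumes "finite S" "set w \<subseteq> S"
  shows "finite {\<sigma> \<in> sorted_along \<omega> w. sum \<sigma> S = m}"
  by (rule finite_subset[OF _ finite_supported_funs_of_sum[OF assms(1), of m]])
    (use assms(2) in \<open>auto simp: sorted_along_def\<close>)

lemma qpoch_Suc: "qpoch (Suc m) = qpoch m * (1 - fps_X ^ Suc m)"
  by (simp add: qpoch_def)

lemma qpoch_nth_0: "qpoch m $ 0 = 1"
  by (induction m) (simp_all add: qpoch_Suc, simp add: qpoch_def)

text \<open>
  Induction on the list. Splitting by whether the value at the first entry \<open>y\<close> is 0, the positive
  part is the whole set shifted, which accounts for the factor \<open>1 / (1 - q ^ length (y # w))\<close>. If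
  that value is 0, the rest is an arbitrary map sorted along \<open>w\<close>, except that at a descent of
  \<open>\<omega>\<close> it must be positive; this is again a shift and costs \<open>q ^ length w\<close>, the term that \<open>maj\<close>
  records.
\<close>
lemma gf_sorted_along:
  assumes "finite S" "set w \<subseteq> S" "distinct w" "inj_on \<omega> S"
  shows "qpoch (length w) * gf (sorted_along \<omega> w) (\<lambda>\<sigma>. sum \<sigma> S) = fps_X ^ maj \<omega> w"
  using assms(2,3)
proof (induction w)
  case Nil
  have "sorted_along \<omega> [] = {\<lambda>_. 0}"
    by (auto simp: sorted_along_def)
  moreover have "{a. a = (\<lambda>_. 0::nat) \<and> sum a S = m} = (if m = 0 then {\<lambda>_. 0} else {})" for m
    by auto
  ultimately show ?case
    by (auto simp: gf_def qpoch_def fps_eq_iff)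
next
  case (Cons y w)
  let ?G = "\<lambda>A. gf A (\<lambda>\<sigma>. sum \<sigma> S)"
  define Z where "Z = {\<sigma> \<in> sorted_along \<omega> (y # w). \<sigma> y = 0}"
  \<comment> \<open>Without a neighbour there is no gap; \<open>hd\<close> is only consulted for a nonempty list.\<close>
  define k where "k = (if w = [] \<or> \<omega> y < \<omega> (hd w) then 0 else length w)"
  have maj_Cons: "maj \<omega> (y # w) = k + maj \<omega> w"
    by (cases w) (auto simp: k_def)
  have split: "?G (sorted_along \<omega> (y # w)) = ?G Z + fps_X ^ Suc (length w) * ?G (sorted_along \<omega> (y # w))"
  proof -
    let ?B = "\<lambda>b. {\<sigma> \<in> sorted_along \<omega> (y # w). (\<sigma> y > 0) = b}"
    have "sorted_along \<omega> (y # w) = (\<Union>b\<in>UNIV. ?B b)" by auto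
    then have "?G (sorted_along \<omega> (y # w)) = ?G (\<Union>b\<in>UNIV. ?B b)" by simp
    also have "\<dots> = (\<Sum>b\<in>UNIV. ?G (?B b))"
    proof (rule gf_UN_disjoint)
      show "finite {\<sigma> \<in> ?B b. sum \<sigma> S = m}" for b m
        by (rule finite_subset[OF _ finite_sorted_along_of_sum[OF assms(1) Cons.prems(1), of \<omega> m]]) auto
    qed auto
    also have "\<dots> = ?G Z + ?G {\<sigma> \<in> sorted_along \<omega> (y # w). \<sigma> y > 0}"
      by (simp add: UNIV_bool Z_def)
    finally show ?thesis
      using gf_sorted_along_positive[OF assms(1) Cons.prems] by simp
  qed
  have Z: "?G Z = fps_X ^ k * ?G (sorted_along \<omega> w)"
  proof (cases w)
    case Nil
    then have "Z = sorted_along \<omega> w"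
      unfolding Z_def sorted_along_def by (auto, metis)
    with Nil show ?thesis by (simp add: k_def)
  next
    case w: (Cons x v)
    have neq: "\<omega> y \<noteq> \<omega> x"
      using Cons.prems assms(4) w by (auto simp: inj_on_def)
    have y0: "\<sigma> y = 0" if "\<sigma> \<in> sorted_along \<omega> w" for \<sigma>
      using that Cons.prems by (auto simp: sorted_along_def)
    \<comment> \<open>By transitivity, \<open>y\<close> has to be compared with its neighbour only.\<close>
    have hd_suffices: "\<sigma> \<in> Z \<longleftrightarrow> \<sigma> \<in> sorted_along \<omega> w \<and> key \<omega> \<sigma> y < key \<omega> \<sigma> x" for \<sigma>
    proof
      assume "\<sigma> \<in> Z"
      then show "\<sigma> \<in> sorted_along \<omega> w \<and> key \<omega> \<sigma> y < key \<omega> \<sigma> x"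
        unfolding Z_def sorted_along_def w
        by (simp del: less_prod_simp) metis
    next
      assume *: "\<sigma> \<in> sorted_along \<omega> w \<and> key \<omega> \<sigma> y < key \<omega> \<sigma> x"
      then have "\<forall>z\<in>set w. key \<omega> \<sigma> y < key \<omega> \<sigma> z"
        unfolding sorted_along_def w by (auto simp del: less_prod_simp intro: less_trans)
      with * y0[of \<sigma>] show "\<sigma> \<in> Z"
        unfolding Z_def sorted_along_def by auto
    qed
    show ?thesis
    proof (cases "\<omega> y < \<omega> x")
      case True
      then have "\<sigma> \<in> Z \<longleftrightarrow> \<sigma> \<in> sorted_along \<omega> w" for \<sigma>
        using hd_suffices[of \<sigma>] y0[of \<sigma>] by auto
      then have "Z = sorted_along \<omega> w" by blast
      with True show ?thesis by (simp add: k_def w)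
    next
      case False
      then have "\<sigma> \<in> Z \<longleftrightarrow> \<sigma> \<in> sorted_along \<omega> w \<and> \<sigma> x > 0" for \<sigma>
        using hd_suffices[of \<sigma>] y0[of \<sigma>] by auto
      then have "Z = {\<sigma> \<in> sorted_along \<omega> w. \<sigma> x > 0}" by blast
      then show ?thesis
        using gf_sorted_along_positive[OF assms(1), of x v \<omega>] Cons.prems False
        by (simp add: k_def w)
    qed
  qed
  have "qpoch (length (y # w)) * ?G (sorted_along \<omega> (y # w)) =
      qpoch (length w) * (?G (sorted_along \<omega> (y # w)) - fps_X ^ Suc (length w) * ?G (sorted_along \<omega> (y # w)))"
    by (simp only: list.size qpoch_Suc add_0_right add_Suc_right) (simp only: algebra_simps mult_1)
  also have "\<dots> = qpoch (length w) * ?G Z"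
    using split by (metis add_diff_cancel_right')
  also have "\<dots> = fps_X ^ k * (qpoch (length w) * ?G (sorted_along \<omega> w))"
    by (simp add: Z ac_simps)
  also have "\<dots> = fps_X ^ maj \<omega> (y # w)"
    using Cons by (simp add: maj_Cons power_add)
  finally show ?case .
qed

section \<open>Linear extensions\<close>

text \<open>
  Stated as the absence of inverted pairs, which is what \<open>sorted_wrt\<close> can express; as the list
  contains all of \<open>S\<close>, this puts the lower element of every pair of \<open>R\<close> first.
\<close>
definition linear_extensions :: "'a set \<Rightarrow> ('a \<times> 'a) set \<Rightarrow> 'a list set" where
  "linear_extensions S R = {w. set w = S \<and> distinct w \<and> sorted_wrt (\<lambda>y x. (x, y) \<notin> R) w}"

text \<open>
  Stanley's \<open>(P, \<omega>)\<close>-partitions: along a pair of \<open>R\<close> the map rises weakly if \<open>\<omega>\<close> rises there,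
  and strictly otherwise. A pair \<open>(y, x)\<close> of \<open>R\<close> means that \<open>y\<close> lies below \<open>x\<close>.
\<close>
definition ppartitions ::
  "'a set \<Rightarrow> ('a \<times> 'a) set \<Rightarrow> ('a \<Rightarrow> int) \<Rightarrow> ('a \<Rightarrow> nat) set" where
  "ppartitions S R \<omega> =
     {\<sigma>. (\<forall>x. x \<notin> S \<longrightarrow> \<sigma> x = 0) \<and> (\<forall>(y, x)\<in>R. key \<omega> \<sigma> y < key \<omega> \<sigma> x)}"

lemma finite_linear_extensions:
  assumes "finite S" shows "finite (linear_extensions S R)"
proof (rule finite_subset)
  show "linear_extensions S R \<subseteq> {w. set w \<subseteq> S \<and> length w \<le> card S}"
    by (auto simp: linear_extensions_def distinct_card)
  show "finite {w. set w \<subseteq> S \<and> length w \<le> card S}"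
    using assms by (rule finite_lists_length_le)
qed

lemma sorted_along_satisfies_iff:
  assumes R: "R \<subseteq> S \<times> S" "irrefl R" and w: "set w = S" and \<sigma>: "\<sigma> \<in> sorted_along \<omega> w"
  shows "(\<forall>(y, x)\<in>R. key \<omega> \<sigma> y < key \<omega> \<sigma> x) \<longleftrightarrow> sorted_wrt (\<lambda>y x. (x, y) \<notin> R) w"
proof
  assume *: "\<forall>(y, x)\<in>R. key \<omega> \<sigma> y < key \<omega> \<sigma> x"
  show "sorted_wrt (\<lambda>y x. (x, y) \<notin> R) w"
    by (rule sorted_wrt_mono_rel[of _ "\<lambda>y x. key \<omega> \<sigma> y < key \<omega> \<sigma> x"])
      (use * \<sigma> in \<open>auto simp: sorted_along_def dest: less_asym\<close>)
next
  assume *: "sorted_wrt (\<lambda>y x. (x, y) \<notin> R) w"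
  show "\<forall>(y, x)\<in>R. key \<omega> \<sigma> y < key \<omega> \<sigma> x"
  proof clarify
    fix y x assume yx: "(y, x) \<in> R"
    then obtain i j where ij: "i < length w" "j < length w" "w ! i = y" "w ! j = x"
      using R w by (metis in_set_conv_nth mem_Sigma_iff subset_iff)
    have "i \<noteq> j" using ij yx R(2) by (auto simp: irrefl_def)
    moreover have "\<not> j < i"
      using * ij yx by (auto simp: sorted_wrt_iff_nth_less)
    ultimately have "i < j" by simp
    with ij \<sigma> show "key \<omega> \<sigma> y < key \<omega> \<sigma> x"
      by (auto simp: sorted_along_def sorted_wrt_iff_nth_less simp del: less_prod_simp)
  qed
qed

lemma ex_sorting_list:
  assumes "finite S" "inj_on \<omega> S" "\<forall>x. x \<notin> S \<longrightarrow> \<sigma> x = 0"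
  shows "\<exists>w. set w = S \<and> distinct w \<and> \<sigma> \<in> sorted_along \<omega> w"
proof -
  obtain xs where xs: "set xs = S" "distinct xs"
    using finite_distinct_list[OF assms(1)] by blast
  let ?w = "sort_key (key \<omega> \<sigma>) xs"
  have "inj_on (key \<omega> \<sigma>) S"
    using assms(2) by (auto simp: inj_on_def)
  then have "sorted_wrt (<) (map (key \<omega> \<sigma>) ?w)"
    using xs by (simp add: strict_sorted_iff distinct_map)
  then have "\<sigma> \<in> sorted_along \<omega> ?w"
    using assms(3) xs by (simp add: sorted_along_def sorted_wrt_map)
  with xs show ?thesis by (intro exI[of _ ?w]) simp
qed

lemma sorting_list_unique:
  assumes "\<sigma> \<in> sorted_along \<omega> w" "\<sigma> \<in> sorted_along \<omega> v" "set w = S" "set v = S" "inj_on \<omega> S"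
  shows "w = v"
proof -
  have "map (key \<omega> \<sigma>) w = map (key \<omega> \<sigma>) v"
    using assms by (intro strict_sorted_equal) (auto simp: sorted_along_def sorted_wrt_map)
  moreover have "inj_on (key \<omega> \<sigma>) (set w \<union> set v)"
    using assms by (auto simp: inj_on_def)
  ultimately show ?thesis by (simp add: inj_on_map_eq_map)
qed

text \<open>
  The fundamental theorem of \<open>P\<close>-partitions. The right-hand side depends on \<open>\<omega>\<close> only through
  the exponents: the set of linear extensions is the same for every \<open>\<omega>\<close>, which is what makes
  \<open>\<omega>\<close> and \<open>-\<omega>\<close> comparable.
\<close>
lemma gf_ppartitions:
  assumes S: "finite S" and R: "R \<subseteq> S \<times> S" "irrefl R" and \<omega>: "inj_on \<omega> S"
  shows "qpoch (card S) * gf (ppartitions S R \<omega>) (\<lambda>\<sigma>. sum \<sigma> S) =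
    (\<Sum>w\<in>linear_extensions S R. fps_X ^ maj \<omega> w)"
proof -
  let ?L = "linear_extensions S R"
  have "ppartitions S R \<omega> = (\<Union>w\<in>?L. sorted_along \<omega> w)"
  proof (intro equalityI subsetI)
    fix \<sigma> assume \<sigma>: "\<sigma> \<in> ppartitions S R \<omega>"
    then obtain w where "set w = S" "distinct w" "\<sigma> \<in> sorted_along \<omega> w"
      using ex_sorting_list[OF S \<omega>] by (auto simp: ppartitions_def)
    with \<sigma> sorted_along_satisfies_iff[OF R] show "\<sigma> \<in> (\<Union>w\<in>?L. sorted_along \<omega> w)"
      by (auto simp: linear_extensions_def ppartitions_def)
  next
    fix \<sigma> assume "\<sigma> \<in> (\<Union>w\<in>?L. sorted_along \<omega> w)"
    then obtain w where w: "w \<in> ?L" "\<sigma> \<in> sorted_along \<omega> w" by blast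
    then have "\<forall>(y, x)\<in>R. key \<omega> \<sigma> y < key \<omega> \<sigma> x"
      by (subst sorted_along_satisfies_iff[OF R]) (auto simp: linear_extensions_def)
    with w show "\<sigma> \<in> ppartitions S R \<omega>"
      by (auto simp: linear_extensions_def ppartitions_def sorted_along_def)
  qed
  then have "gf (ppartitions S R \<omega>) (\<lambda>\<sigma>. sum \<sigma> S) = (\<Sum>w\<in>?L. gf (sorted_along \<omega> w) (\<lambda>\<sigma>. sum \<sigma> S))"
    using finite_linear_extensions[OF S] finite_sorted_along_of_sum[OF S] sorting_list_unique[OF _ _ _ _ \<omega>]
    by (simp only:, intro gf_UN_disjoint) (auto simp: linear_extensions_def)
  then show ?thesis
    using gf_sorted_along[OF S _ _ \<omega>]
    by (auto simp: sum_distrib_left linear_extensions_def distinct_card intro!: sum.cong)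
qed

section \<open>Palindromic polynomials\<close>

lemma palindromic_if_reflect:
  assumes "reflect_poly p = p"
  shows "palindromic p"
proof -
  have X: "fls_X ^ degree p * fls_X_inv ^ i = (fls_X :: int fls) ^ (degree p - i)"
    if "i \<le> degree p" for i
  proof -
    have "fls_X ^ degree p * fls_X_inv ^ i =
        (fls_X ^ (degree p - i) * (fls_X * fls_X_inv) ^ i :: int fls)"
      using that by (simp add: power_mult_distrib flip: power_add mult.assoc)
    moreover have "fls_X * fls_X_inv = (1 :: int fls)"
      by (simp add: fls_X_inv_times_conv_shift)
    ultimately show ?thesis by simp
  qed
  have c: "coeff p (degree p - i) = coeff p i" if "i \<le> degree p" for i
    using assms that coeff_reflect_poly[of p i] by simp
  have deg: "degree (map_poly fls_const p) = degree p"
    by (rule degree_map_poly) auto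
  have "fls_X ^ degree p * poly (map_poly fls_const p) fls_X_inv =
      (\<Sum>i\<le>degree p. fls_const (coeff p i) * (fls_X ^ degree p * fls_X_inv ^ i))"
    by (simp add: poly_altdef deg coeff_map_poly sum_distrib_left ac_simps)
  also have "\<dots> = (\<Sum>i\<le>degree p. fls_const (coeff p (degree p - i)) * fls_X ^ (degree p - i))"
    by (intro sum.cong) (auto simp: X c)
  also have "\<dots> = (\<Sum>i\<le>degree p. fls_const (coeff p i) * fls_X ^ i)"
    using sum.nat_diff_reindex[of "\<lambda>i. fls_const (coeff p i) * fls_X ^ i" "Suc (degree p)"]
    by (simp add: lessThan_Suc_atMost)
  also have "\<dots> = poly (map_poly fls_const p) fls_X"
    by (simp add: poly_altdef deg coeff_map_poly)
  finally show ?thesis by (simp add: palindromic_def)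
qed

text \<open>
  With \<open>p(q) = (\<Sum>w. q ^ e w)\<close> the assumptions say \<open>q ^ C * p(1/q) = q ^ h * p(q)\<close>. The nonzero
  constant coefficient pins down the degree: the left-hand side has degree exactly \<open>C\<close>, so
  \<open>degree p = C - h\<close>.
\<close>
lemma reflect_poly_eq_if_complement:
  fixes e e' :: "'a \<Rightarrow> nat" and C h :: nat and L :: "'a set"
  defines "p \<equiv> (\<Sum>w\<in>L. monom (1::int) (e w))"
  assumes comp: "\<And>w. w \<in> L \<Longrightarrow> e w + e' w = C"
    and shift: "(\<Sum>w\<in>L. monom 1 (e' w)) = monom 1 h * p"
    and p0: "coeff p 0 \<noteq> 0"
  shows "reflect_poly p = p"
proof -
  have rev: "coeff (monom 1 h * p) k = (if k \<le> C then coeff p (C - k) else 0)" for k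
  proof -
    have "coeff (monom 1 h * p) k = (\<Sum>w\<in>L. if e' w = k then 1 else 0)"
      unfolding shift[symmetric] by (simp add: coeff_sum)
    also have "\<dots> = (\<Sum>w\<in>L. if k \<le> C \<and> e w = C - k then 1 else 0)"
    proof (rule sum.cong[OF refl])
      fix w assume "w \<in> L"
      then have "e' w = k \<longleftrightarrow> k \<le> C \<and> e w = C - k" using comp[of w] by auto
      then show "(if e' w = k then 1 else 0) = (if k \<le> C \<and> e w = C - k then 1 else (0::int))"
        by simp
    qed
    also have "\<dots> = (if k \<le> C then coeff p (C - k) else 0)"
      by (simp add: p_def coeff_sum)
    finally show ?thesis .
  qed
  have shifted: "coeff (monom 1 h * p) (h + k) = coeff p k" for k
    by (simp add: coeff_monom_mult)
  have "coeff p (degree p) \<noteq> 0"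
    using p0 by auto
  then have le: "h + degree p \<le> C"
    using rev[of "h + degree p"] shifted[of "degree p"] by (auto split: if_splits)
  have "coeff (monom 1 h * p) C \<noteq> 0"
    using rev[of C] p0 by simp
  then have "C - h \<le> degree p"
    using shifted[of "C - h"] le by (auto intro: le_degree)
  with le have C: "C = h + degree p" by simp
  show ?thesis
  proof (rule poly_eqI)
    fix k
    show "coeff (reflect_poly p) k = coeff p k"
      using rev[of "h + k"] shifted[of k] C
      by (auto simp: coeff_reflect_poly coeff_eq_0)
  qed
qed

section \<open>Graded relations\<close>

text \<open>
  The hypothesis \<open>bottom\<close> lets the height be subtracted from a strictly increasing map: descending
  from \<open>x\<close> along \<open>R\<close> to height 0 takes \<open>h x\<close> strict steps, so the value at \<open>x\<close> is at least
  \<open>h x\<close>.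
\<close>
lemma palindromic_gf_graded:
  fixes S :: "'a set" and h :: "'a \<Rightarrow> nat"
  assumes S: "finite S" and R: "R \<subseteq> S \<times> S"
    and graded: "\<And>y x. (y, x) \<in> R \<Longrightarrow> h x = Suc (h y)"
    and bottom: "\<And>x. x \<in> S \<Longrightarrow> h x > 0 \<Longrightarrow> \<exists>y. (y, x) \<in> R"
  shows "\<exists>p. qpoch (card S) *
      gf {\<sigma>. (\<forall>x. x \<notin> S \<longrightarrow> \<sigma> x = 0) \<and> (\<forall>(y, x)\<in>R. \<sigma> y \<le> \<sigma> x)} (\<lambda>\<sigma>. sum \<sigma> S) = fps_of_poly p \<and>
    palindromic p"
proof -
  let ?G = "\<lambda>A. gf A (\<lambda>\<sigma>. sum \<sigma> S)"
  let ?L = "linear_extensions S R"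
  have irr: "irrefl R"
    using graded by (fastforce simp: irrefl_def)
  obtain e where e: "bij_betw e S {0..<card S}"
    using ex_bij_betw_finite_nat[OF S] by blast
  \<comment> \<open>The height decides and \<open>e\<close> breaks ties, which makes the numbering injective while it still
    increases along \<open>R\<close>.\<close>
  define \<omega> where "\<omega> x = int (h x * card S + e x)" for x
  have eless: "e x < card S" if "x \<in> S" for x
    using e that by (auto simp: bij_betw_def)
  have \<omega>_inj: "inj_on \<omega> S"
  proof (rule inj_onI)
    fix x y assume xy: "x \<in> S" "y \<in> S" "\<omega> x = \<omega> y"
    then have "(h x * card S + e x) mod card S = (h y * card S + e y) mod card S"
      by (simp only: \<omega>_def of_nat_eq_iff)
    then have "e x = e y" using xy eless by simp
    with e xy show "x = y" by (auto simp: bij_betw_def inj_on_def)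
  qed
  have \<omega>_less: "\<omega> y < \<omega> x" if "(y, x) \<in> R" for y x
  proof -
    have "e y < card S" using that R eless by auto
    with graded[OF that] show ?thesis by (simp add: \<omega>_def)
  qed
  define A where "A = {\<sigma> :: 'a \<Rightarrow> nat. (\<forall>x. x \<notin> S \<longrightarrow> \<sigma> x = 0) \<and> (\<forall>(y, x)\<in>R. \<sigma> y \<le> \<sigma> x)}"
  define B where "B = {\<sigma> :: 'a \<Rightarrow> nat. (\<forall>x. x \<notin> S \<longrightarrow> \<sigma> x = 0) \<and> (\<forall>(y, x)\<in>R. \<sigma> y < \<sigma> x)}"
  have A: "ppartitions S R \<omega> = A"
    unfolding ppartitions_def A_def using \<omega>_less by fastforce
  have B: "ppartitions S R (\<lambda>x. - \<omega> x) = B"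
    unfolding ppartitions_def B_def using \<omega>_less by fastforce
  have BA: "?G B = fps_X ^ sum h S * ?G A"
  proof (rule gf_shift_bij)
    let ?up = "\<lambda>(\<sigma> :: 'a \<Rightarrow> nat) x. if x \<in> S then \<sigma> x + h x else 0"
    let ?dn = "\<lambda>(\<sigma> :: 'a \<Rightarrow> nat) x. \<sigma> x - h x"
    have ge: "h x \<le> \<sigma> x" if "\<sigma> \<in> B" "x \<in> S" for \<sigma> x
      using that(2)
    proof (induction "h x" arbitrary: x)
      case (Suc k)
      then obtain y where y: "(y, x) \<in> R" using bottom[of x] by auto
      then have "y \<in> S" using R by auto
      then have "h y \<le> \<sigma> y" using Suc graded[OF y] by auto
      moreover have "\<sigma> y < \<sigma> x" using that(1) y by (auto simp: B_def)
      ultimately show ?case using graded[OF y] by simp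
    qed simp
    show "bij_betw ?up A B"
    proof (rule bij_betw_byWitness[where f' = ?dn])
      show "\<forall>\<sigma>\<in>A. ?dn (?up \<sigma>) = \<sigma>"
        by (auto simp: A_def fun_eq_iff)
      show "\<forall>\<sigma>\<in>B. ?up (?dn \<sigma>) = \<sigma>"
        using ge by (auto simp: B_def fun_eq_iff)
      show "?up ` A \<subseteq> B"
        using R graded by (fastforce simp: A_def B_def)
      show "?dn ` B \<subseteq> A"
      proof clarify
        fix \<sigma> assume \<sigma>: "\<sigma> \<in> B"
        have "\<sigma> y - h y \<le> \<sigma> x - h x" if "(y, x) \<in> R" for y x
        proof -
          have "y \<in> S" "x \<in> S" "\<sigma> y < \<sigma> x" using that R \<sigma> by (auto simp: B_def)
          then show ?thesis using graded[OF that] ge[OF \<sigma>, of y] ge[OF \<sigma>, of x] by simp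
        qed
        then show "?dn \<sigma> \<in> A"
          using \<sigma> by (auto simp: A_def B_def)
      qed
    qed
    show "sum (?up \<sigma>) S = sum \<sigma> S + sum h S" for \<sigma>
      by (simp add: sum.distrib)
  qed
  let ?p = "\<Sum>w\<in>?L. monom (1::int) (maj \<omega> w)"
  let ?p' = "\<Sum>w\<in>?L. monom (1::int) (maj (\<lambda>x. - \<omega> x) w)"
  have p: "qpoch (card S) * ?G A = fps_of_poly ?p"
    using gf_ppartitions[OF S R irr \<omega>_inj]
    by (simp add: A fps_of_poly_sum fps_of_poly_monom')
  have "inj_on (\<lambda>x. - \<omega> x) S"
    using \<omega>_inj by (auto simp: inj_on_def)
  from gf_ppartitions[OF S R irr this]
  have "fps_of_poly ?p' = qpoch (card S) * ?G B"
    by (simp add: B fps_of_poly_sum fps_of_poly_monom')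
  also have "\<dots> = fps_X ^ sum h S * fps_of_poly ?p"
    by (simp add: BA ac_simps flip: p)
  also have "\<dots> = fps_of_poly (monom 1 (sum h S) * ?p)"
    by (simp add: fps_of_poly_mult fps_of_poly_monom')
  finally have p': "?p' = monom 1 (sum h S) * ?p"
    by simp
  have "{\<sigma> \<in> A. sum \<sigma> S = 0} = {\<lambda>_. 0}"
    using S by (auto simp: A_def)
  then have "?G A $ 0 = 1"
    by (simp add: gf_def)
  moreover have "qpoch (card S) $ 0 = 1"
    by (rule qpoch_nth_0)
  ultimately have "fps_of_poly ?p $ 0 = 1"
    by (simp flip: p)
  then have p0: "coeff ?p 0 \<noteq> 0"
    by simp
  have "reflect_poly ?p = ?p"
    by (rule reflect_poly_eq_if_complement[where C = "\<Sum>{..<card S}", OF _ p' p0])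
      (use \<omega>_inj maj_add_maj_uminus[of _ \<omega>] in \<open>auto simp: linear_extensions_def distinct_card\<close>)
  with p show ?thesis
    unfolding A_def by (blast intro: palindromic_if_reflect)
qed

section \<open>Double shifted plane partitions as graded relations\<close>

text \<open>The pairs \<open>(a, b)\<close> of neighbouring rows for which row \<open>a\<close> has to interlace above row \<open>b\<close>.\<close>
fun step_pairs :: "profile \<Rightarrow> (nat \<times> nat) set" where
  "step_pairs (d1, d2, d3) =
     {if d1 = 0 then (0, 1) else (1, 0), if d2 = 0 then (1, 2) else (2, 1),
      if d3 = 0 then (2, 3) else (3, 2)}"

lemma step_pairs_less_4: "(a, b) \<in> step_pairs c \<Longrightarrow> a < 4 \<and> b < 4"
  by (cases c) (auto split: if_splits)

text \<open>
  Row \<open>a\<close> interlaces above row \<open>b\<close> if entry \<open>i\<close> of \<open>b\<close> lies between the entries \<open>i\<close> and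
  \<open>Suc i\<close> of \<open>a\<close>. As before, the lower position comes first in a pair.
\<close>
definition entry_rel :: "profile \<Rightarrow> nat \<Rightarrow> ((nat \<times> nat) \<times> (nat \<times> nat)) set" where
  "entry_rel c n =
     {((b, i), (a, i)) |a b i. (a, b) \<in> step_pairs c \<and> i < n} \<union>
     {((a, Suc i), (b, i)) |a b i. (a, b) \<in> step_pairs c \<and> Suc i < n}"

fun row :: "quad \<Rightarrow> nat \<Rightarrow> nat \<Rightarrow> nat" where
  "row (l0, l1, l2, l3) j =
     (if j = 0 then l0 else if j = 1 then l1 else if j = 2 then l2 else if j = 3 then l3
      else (\<lambda>_. 0))"

lemma all_less_4: "(\<forall>j<4. P j) \<longleftrightarrow> P 0 \<and> P 1 \<and> P 2 \<and> P (3::nat)"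
  by (auto simp: numeral_eq_Suc less_Suc_eq)

lemma row_of_columns: "j < 4 \<Longrightarrow> row (f 0, f 1, f 2, f 3) j = f j"
  by (auto simp: numeral_eq_Suc less_Suc_eq)

lemma row_ge_4: "j \<ge> 4 \<Longrightarrow> row \<Lambda> j = (\<lambda>_. 0)"
  by (cases \<Lambda>) auto

lemma partition_length_le_iff:
  "is_partition \<nu> \<and> plength \<nu> \<le> n \<longleftrightarrow> antimono \<nu> \<and> (\<forall>i\<ge>n. \<nu> i = 0)"
proof (intro iffI conjI allI impI)
  assume *: "is_partition \<nu> \<and> plength \<nu> \<le> n"
  then show anti: "antimono \<nu>" by (simp add: is_partition_def)
  fix i assume i: "n \<le> i"
  show "\<nu> i = 0"
  proof (rule ccontr)
    assume "\<nu> i \<noteq> 0"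
    then have "{..i} \<subseteq> {i. \<nu> i > 0}"
      using antimonoD[OF anti] by (auto simp: Suc_le_eq[symmetric] intro: order_trans)
    then have "Suc i \<le> plength \<nu>"
      using card_mono[of "{i. \<nu> i > 0}" "{..i}"] * by (simp add: plength_def is_partition_def)
    with * i show False by simp
  qed
next
  assume *: "antimono \<nu> \<and> (\<forall>i\<ge>n. \<nu> i = 0)"
  then have sub: "{i. \<nu> i > 0} \<subseteq> {..<n}"
    by (auto intro: ccontr simp: not_less)
  with * show "is_partition \<nu>"
    by (auto simp: is_partition_def intro: finite_subset)
  show "plength \<nu> \<le> n"
    using card_mono[OF _ sub] by (simp add: plength_def)
qed

lemma psize_eq_sum:
  assumes "\<forall>i\<ge>n. \<nu> i = 0"
  shows "psize \<nu> = sum \<nu> {..<n}"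
  unfolding psize_def using assms
  by (intro sum.mono_neutral_left) (auto intro: ccontr simp: not_less)

lemma interlaces_antimono:
  assumes "interlaces \<nu> \<mu>" shows "antimono \<nu>" "antimono \<mu>"
  using assms unfolding interlaces_def antimono_iff_le_Suc by (meson order_trans)+

text \<open>
  Every row takes part in an interlacing condition, and interlacing already forces both rows to be
  weakly decreasing; what remains of being a partition with at most \<open>n\<close> parts is the vanishing
  from index \<open>n\<close> on.
\<close>
lemma DSPP_iff:
  assumes c: "c \<in> {0, 1} \<times> {0, 1} \<times> {0, 1}"
  shows "\<Lambda> \<in> DSPP c n \<longleftrightarrow>
    (\<forall>j<4. \<forall>i\<ge>n. row \<Lambda> j i = 0) \<and> (\<forall>(a, b)\<in>step_pairs c. interlaces (row \<Lambda> a) (row \<Lambda> b))"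
proof -
  obtain d1 d2 d3 where d: "c = (d1, d2, d3)" by (cases c)
  obtain l0 l1 l2 l3 where l: "\<Lambda> = (l0, l1, l2, l3)" by (cases \<Lambda>)
  have steps: "(\<forall>(a, b)\<in>step_pairs c. interlaces (row \<Lambda> a) (row \<Lambda> b)) \<longleftrightarrow>
      profile_step d1 l0 l1 \<and> profile_step d2 l1 l2 \<and> profile_step d3 l2 l3"
    using c by (auto simp: d l profile_step_def)
  have anti: "antimono l0 \<and> antimono l1 \<and> antimono l2 \<and> antimono l3"
    if "profile_step d1 l0 l1 \<and> profile_step d2 l1 l2 \<and> profile_step d3 l2 l3"
    using that interlaces_antimono by (auto simp: profile_step_def)
  have "\<Lambda> \<in> DSPP c n \<longleftrightarrow>
      (is_partition l0 \<and> plength l0 \<le> n) \<and> (is_partition l1 \<and> plength l1 \<le> n) \<and>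
      (is_partition l2 \<and> plength l2 \<le> n) \<and> (is_partition l3 \<and> plength l3 \<le> n) \<and>
      profile_step d1 l0 l1 \<and> profile_step d2 l1 l2 \<and> profile_step d3 l2 l3"
    by (auto simp: DSPP_def d l)
  also have "\<dots> \<longleftrightarrow> (\<forall>j<4. \<forall>i\<ge>n. row \<Lambda> j i = 0) \<and>
      profile_step d1 l0 l1 \<and> profile_step d2 l1 l2 \<and> profile_step d3 l2 l3"
    unfolding partition_length_le_iff all_less_4 using anti by (auto simp: l)
  finally show ?thesis by (simp only: steps)
qed

lemma F_dspp_eq_gf:
  fixes n :: nat
  assumes c: "c \<in> {0, 1} \<times> {0, 1} \<times> {0, 1}"
  defines "S \<equiv> {..<4} \<times> {..<n}"
  shows "F_dspp c n =
    gf {\<sigma>. (\<forall>x. x \<notin> S \<longrightarrow> \<sigma> x = 0) \<and> (\<forall>(y, x)\<in>entry_rel c n. \<sigma> y \<le> \<sigma> x)} (\<lambda>\<sigma>. sum \<sigma> S)"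
    (is "_ = gf ?A _")
proof -
  let ?f = "\<lambda>\<Lambda>. \<lambda>(j, i). row \<Lambda> j i"
  let ?g = "\<lambda>(\<sigma> :: nat \<times> nat \<Rightarrow> nat). (\<lambda>i. \<sigma> (0, i), \<lambda>i. \<sigma> (1, i), \<lambda>i. \<sigma> (2, i), \<lambda>i. \<sigma> (3, i))"
  note lt4 = step_pairs_less_4[of _ _ c]
  have supp: "(\<forall>x. x \<notin> S \<longrightarrow> ?f \<Lambda> x = 0) \<longleftrightarrow> (\<forall>j<4. \<forall>i\<ge>n. row \<Lambda> j i = 0)" for \<Lambda>
    using row_ge_4[of _ \<Lambda>] unfolding S_def
    by (auto simp: not_less simp del: row.simps) (metis not_less)
  have rel: "(\<forall>(y, x)\<in>entry_rel c n. ?f \<Lambda> y \<le> ?f \<Lambda> x) \<longleftrightarrow>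
      (\<forall>(a, b)\<in>step_pairs c. interlaces (row \<Lambda> a) (row \<Lambda> b))"
    if *: "\<forall>j<4. \<forall>i\<ge>n. row \<Lambda> j i = 0" for \<Lambda>
  proof -
    have "interlaces (row \<Lambda> a) (row \<Lambda> b) \<longleftrightarrow>
        (\<forall>i<n. row \<Lambda> b i \<le> row \<Lambda> a i) \<and> (\<forall>i. Suc i < n \<longrightarrow> row \<Lambda> a (Suc i) \<le> row \<Lambda> b i)"
      if "(a, b) \<in> step_pairs c" for a b
      using * lt4[OF that] unfolding interlaces_def by (metis le0 not_less)
    then show ?thesis
      unfolding entry_rel_def by fastforce
  qed
  have f: "?f \<Lambda> \<in> ?A \<longleftrightarrow> \<Lambda> \<in> DSPP c n" for \<Lambda>
    unfolding DSPP_iff[OF c] mem_Collect_eq supp using rel[of \<Lambda>] by blast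
  have gf_id: "?g (?f \<Lambda>) = \<Lambda>" for \<Lambda>
    by (cases \<Lambda>) simp
  have fg_id: "?f (?g \<sigma>) = \<sigma>" if "\<sigma> \<in> ?A" for \<sigma>
  proof
    fix x :: "nat \<times> nat"
    obtain j i where x: "x = (j, i)" by (cases x)
    show "?f (?g \<sigma>) x = \<sigma> x"
    proof (cases "j < 4")
      case True
      then show ?thesis using row_of_columns[of j "\<lambda>j i. \<sigma> (j, i)"] by (simp add: x)
    next
      case False
      with that have "\<sigma> x = 0" by (auto simp: x S_def)
      with False show ?thesis by (simp add: x)
    qed
  qed
  have "gf ?A (\<lambda>\<sigma>. sum \<sigma> S) = fps_X ^ 0 * gf (DSPP c n) dspp_size"
  proof (rule gf_shift_bij)
    show "bij_betw ?f (DSPP c n) ?A"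
    proof (rule bij_betw_byWitness[where f' = ?g])
      show "\<forall>\<Lambda>\<in>DSPP c n. ?g (?f \<Lambda>) = \<Lambda>"
        using gf_id by (intro ballI)
      show "\<forall>\<sigma>\<in>?A. ?f (?g \<sigma>) = \<sigma>"
        using fg_id by (intro ballI)
      show "?f ` DSPP c n \<subseteq> ?A"
        using f by (intro image_subsetI) (rule iffD2)
      show "?g ` ?A \<subseteq> DSPP c n"
      proof (rule image_subsetI)
        fix \<sigma> assume \<sigma>: "\<sigma> \<in> ?A"
        have "?f (?g \<sigma>) \<in> ?A" by (subst fg_id[OF \<sigma>]) (rule \<sigma>)
        then show "?g \<sigma> \<in> DSPP c n" by (rule iffD1[OF f])
      qed
    qed
    fix \<Lambda> assume "\<Lambda> \<in> DSPP c n"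
    then have z: "\<forall>j<4. \<forall>i\<ge>n. row \<Lambda> j i = 0"
      by (simp add: DSPP_iff[OF c])
    have "sum (?f \<Lambda>) S = (\<Sum>j<4. \<Sum>i<n. row \<Lambda> j i)"
      by (simp add: S_def sum.cartesian_product)
    also have "\<dots> = (\<Sum>j<4. psize (row \<Lambda> j))"
      using z psize_eq_sum by (intro sum.cong) auto
    also have "\<dots> = dspp_size \<Lambda>"
      by (cases \<Lambda>) (simp add: numeral_eq_Suc)
    finally show "sum (?f \<Lambda>) S = dspp_size \<Lambda> + 0" by simp
  qed
  then show ?thesis by (simp add: F_dspp_def gf_def)
qed

text \<open>
  If \<open>off\<close> is a height on the rows, then \<open>off j + 2 * (n - Suc i)\<close> is one on the positions:
  passing from \<open>(a, i)\<close> down to \<open>(b, i)\<close> and on to \<open>(a, Suc i)\<close> loses 1 each time. Only the last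
  entries of the rows can have nothing below them, and \<open>zero\<close> requires height 0 for those that do.
\<close>
lemma palindromic_P_dspp:
  assumes c: "c \<in> {0, 1} \<times> {0, 1} \<times> {0, 1}"
    and off: "\<And>a b. (a, b) \<in> step_pairs c \<Longrightarrow> off a = Suc (off b)"
    and zero: "\<And>j. j < 4 \<Longrightarrow> off j > 0 \<Longrightarrow> \<exists>b. (j, b) \<in> step_pairs c"
  shows "\<exists>p. P_dspp c n = fps_of_poly p \<and> palindromic p"
proof -
  let ?S = "{..<4::nat} \<times> {..<n}"
  let ?h = "\<lambda>(j, i). off j + 2 * (n - Suc i)"
  note lt4 = step_pairs_less_4[of _ _ c]
  have covered: "\<exists>k. (j, k) \<in> step_pairs c \<or> (k, j) \<in> step_pairs c" if "j < 4" for j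
  proof -
    have "j = 0 \<or> j = 1 \<or> j = 2 \<or> j = 3" using that by linarith
    then show ?thesis by (elim disjE) (cases c; force)+
  qed
  have "\<exists>p. qpoch (card ?S) * gf {\<sigma>. (\<forall>x. x \<notin> ?S \<longrightarrow> \<sigma> x = 0) \<and>
      (\<forall>(y, x)\<in>entry_rel c n. \<sigma> y \<le> \<sigma> x)} (\<lambda>\<sigma>. sum \<sigma> ?S) = fps_of_poly p \<and> palindromic p"
  proof (rule palindromic_gf_graded[where h = ?h])
    show "entry_rel c n \<subseteq> ?S \<times> ?S"
      using lt4 by (auto simp: entry_rel_def)
    show "?h x = Suc (?h y)" if "(y, x) \<in> entry_rel c n" for y x
      using that by (auto simp: entry_rel_def off)
    fix x assume x: "x \<in> ?S" "?h x > 0"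
    obtain j i where ji: "x = (j, i)" "j < 4" "i < n" using x by auto
    show "\<exists>y. (y, x) \<in> entry_rel c n"
    proof (cases "\<exists>b. (j, b) \<in> step_pairs c")
      case True
      with ji show ?thesis by (auto simp: entry_rel_def)
    next
      case False
      with zero ji x have "Suc i < n" by fastforce
      with False covered ji show ?thesis by (fastforce simp: entry_rel_def)
    qed
  qed simp
  then show ?thesis
    by (simp add: P_dspp_def F_dspp_eq_gf[OF c])
qed

theorem theorem7p1:
  fixes n :: nat and c :: profile
  assumes "c \<in> {(0, 1, 0), (0, 0, 0), (0, 0, 1)}"
  shows "\<exists>p :: int poly. P_dspp c n = fps_of_poly p \<and> palindromic p"
proof -
  consider "c = (0, 1, 0)" | "c = (0, 0, 0)" | "c = (0, 0, 1)" using assms by blast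
  then show ?thesis
  proof cases
    case 1
    then show ?thesis
      by (intro palindromic_P_dspp[where off = "(!) [1, 0, 1, 0]"])
        (auto simp: numeral_eq_Suc less_Suc_eq)
  next
    case 2
    then show ?thesis
      by (intro palindromic_P_dspp[where off = "(!) [3, 2, 1, 0]"])
        (auto simp: numeral_eq_Suc less_Suc_eq)
  next
    case 3
    then show ?thesis
      by (intro palindromic_P_dspp[where off = "(!) [2, 1, 0, 1]"])
        (auto simp: numeral_eq_Suc less_Suc_eq)
  qed
qed

end
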